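(* Let $(X,d)$ be a distance space. The set $T=\{U\subseteq X \mid U \text{ is open in } (X,d)\}$ is a topology on $X$, and $(X,T)$ is a topological space.
   Context: A distance on a set $X$ is a function $d:X\times X\to\mathbb{R}$ such that for all $x,y\in X$: $d(x,y)\ge 0$; $d(x,y)=0\iff x=y$; $d(x,y)=d(y,x)$ (no triangle inequality is assumed). The pair $(X,d)$ is then a distance space. For $x\in X$ and real $r>0$, the open ball is $B(x,r)=\{y\in X\mid d(x,y)<r\}$. A set $U\subseteq X$ is open in $(X,d)$ if for every $x\in U$ there exists a real $r>0$ such that $B(x,r)\subseteq U$. *)

theory Defs
  imports "HOL-Analysis.Abstract_Topology"
begin

text \<open>
  A distance space: \<open>Metric_space\<close> without the triangle inequality. All conditions on \<open>d\<close>
  are relative to the carrier \<open>X\<close>; the values of \<open>d\<close> outside \<open>X \<times> X\<close> are irrelevant.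
\<close>

locale distance_space =
  fixes X :: "'a set" and d :: "'a \<Rightarrow> 'a \<Rightarrow> real"
  assumes nonneg: "\<And>x y. \<lbrakk>x \<in> X; y \<in> X\<rbrakk> \<Longrightarrow> 0 \<le> d x y"
    and zero: "\<And>x y. \<lbrakk>x \<in> X; y \<in> X\<rbrakk> \<Longrightarrow> d x y = 0 \<longleftrightarrow> x = y"
    and commute: "\<And>x y. \<lbrakk>x \<in> X; y \<in> X\<rbrakk> \<Longrightarrow> d x y = d y x"

definition dist_ball :: "'a set \<Rightarrow> ('a \<Rightarrow> 'a \<Rightarrow> real) \<Rightarrow> 'a \<Rightarrow> real \<Rightarrow> 'a set" where
  "dist_ball X d x r = {y \<in> X. d x y < r}"

definition dist_open :: "'a set \<Rightarrow> ('a \<Rightarrow> 'a \<Rightarrow> real) \<Rightarrow> 'a set \<Rightarrow> bool" where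
  "dist_open X d U \<longleftrightarrow> U \<subseteq> X \<and> (\<forall>x\<in>U. \<exists>r>0. dist_ball X d x r \<subseteq> U)"

definition dist_opens :: "'a set \<Rightarrow> ('a \<Rightarrow> 'a \<Rightarrow> real) \<Rightarrow> 'a set set" where
  "dist_opens X d = {U. U \<subseteq> X \<and> dist_open X d U}"

text \<open>
  \<open>istopology\<close> does not mention the underlying set, so that \<open>T\<close> is a topology on \<open>X\<close> also
  requires the underlying set of the resulting space to be \<open>X\<close>. Together with \<open>istopology\<close>,
  this gives \<open>X \<in> T\<close>; that \<open>{} \<in> T\<close> is the case of the empty union.
\<close>

definition topology_on :: "'a set \<Rightarrow> 'a set set \<Rightarrow> bool" where
  "topology_on X T \<longleftrightarrow> istopology (\<lambda>U. U \<in> T) \<and> topspace (topology (\<lambda>U. U \<in> T)) = X"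

end

theory Submission
  imports Defs
begin

text \<open>Openness asks for some ball around each point, and balls with a common centre are nested
  by radius. The smaller of two radii therefore serves an intersection
  (\<open>dist_open_Int\<close>), and a radius that works for one member works for the union
  (\<open>dist_open_Union\<close>); together these give \<open>istopology\<close>. Since
  \<open>X\<close> itself is open (\<open>dist_open_carrier\<close>), the underlying set is all of
  \<open>X\<close>.\<close>

lemma dist_ball_mono: "r \<le> s \<Longrightarrow> dist_ball X d x r \<subseteq> dist_ball X d x s"
  by (auto simp: dist_ball_def)

lemma dist_open_Int:
  assumes "dist_open X d U" "dist_open X d V"
  shows "dist_open X d (U \<inter> V)"
  unfolding dist_open_def
proof (intro conjI ballI)
  show "U \<inter> V \<subseteq> X"
    using assms by (auto simp: dist_open_def)
next
  fix x assume "x \<in> U \<inter> V"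
  then obtain r s where "r > 0" "dist_ball X d x r \<subseteq> U" "s > 0" "dist_ball X d x s \<subseteq> V"
    using assms by (meson IntD1 IntD2 dist_open_def)
  then have "min r s > 0" "dist_ball X d x (min r s) \<subseteq> U \<inter> V"
    using dist_ball_mono[of "min r s" r X d x] dist_ball_mono[of "min r s" s X d x] by auto
  then show "\<exists>r>0. dist_ball X d x r \<subseteq> U \<inter> V"
    by blast
qed

text \<open>A ball inside one member stays inside the union. The family may be empty, which covers
  the empty set.\<close>

lemma dist_open_Union:
  assumes "\<And>U. U \<in> \<U> \<Longrightarrow> dist_open X d U"
  shows "dist_open X d (\<Union>\<U>)"
  using assms unfolding dist_open_def by (meson Union_iff Union_least Union_upper subset_trans)

lemma dist_open_carrier: "dist_open X d X"
  \<comment> \<open>Balls are cut out of \<open>X\<close> by definition, so any positive radius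
    works; \<open>zero_less_one\<close> supplies radius 1.\<close>
  by (auto simp: dist_open_def dist_ball_def intro: zero_less_one)

lemma mem_dist_opens: "U \<in> dist_opens X d \<longleftrightarrow> dist_open X d U"
  by (auto simp: dist_opens_def dist_open_def)

lemma istopology_dist_opens: "istopology (\<lambda>U. U \<in> dist_opens X d)"
  by (auto simp: istopology_def mem_dist_opens intro: dist_open_Int dist_open_Union)

text \<open>\<open>topology\<close> is inverse to \<open>openin\<close> only on predicates
  satisfying \<open>istopology\<close>, so this rests on
  \<open>istopology_dist_opens\<close>.\<close>

lemma openin_dist_opens:
  "openin (topology (\<lambda>U. U \<in> dist_opens X d)) U \<longleftrightarrow> U \<in> dist_opens X d"
  by (simp add: istopology_dist_opens)

text \<open>\<open>topspace\<close> is the union of all open sets; each lies in \<open>X\<close>,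
  and \<open>X\<close> is one of them.\<close>

lemma topspace_dist_opens: "topspace (topology (\<lambda>U. U \<in> dist_opens X d)) = X"
proof -
  have "\<Union>(dist_opens X d) = X"
  proof
    show "\<Union>(dist_opens X d) \<subseteq> X"
      by (auto simp: dist_opens_def)
    show "X \<subseteq> \<Union>(dist_opens X d)"
      using dist_open_carrier by (intro Union_upper) (simp add: mem_dist_opens)
  qed
  then show ?thesis
    by (simp only: topspace_def openin_dist_opens Collect_mem_eq)
qed

theorem corollary3p8:
  fixes X :: "'a set" and d :: "'a \<Rightarrow> 'a \<Rightarrow> real"
  assumes "distance_space X d"
  shows "topology_on X (dist_opens X d) \<and>
    (\<exists>S :: 'a topology. topspace S = X \<and> {U. openin S U} = dist_opens X d)"
proof
  show "topology_on X (dist_opens X d)"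
    by (simp add: topology_on_def istopology_dist_opens topspace_dist_opens)
  show "\<exists>S :: 'a topology. topspace S = X \<and> {U. openin S U} = dist_opens X d"
    \<comment> \<open>The witness is the topology whose open sets are exactly the members of
      \<open>dist_opens X d\<close>.\<close>
    by (rule exI[of _ "topology (\<lambda>U. U \<in> dist_opens X d)"])
      (simp only: topspace_dist_opens openin_dist_opens Collect_mem_eq simp_thms)
qed

end
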